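(* Let $\mathbb{F}$ be a field containing a subfield isomorphic to $\mathbb{Q}$, and let $\mathscr{U}$ be the unital associative $\mathbb{F}$-algebra with generators $x,y$ and relation $xy-yx=x$, regarded as a Lie algebra under the commutator bracket. For each integer $n\geq 0$ let $\mathcal{F}_n$ be the $\mathbb{F}$-linear span of all basis elements $x^ky^l$ ($k,l\geq 0$) of $\mathscr{U}$ with $l\leq n$. Then the sequence $(\mathcal{F}_n)_{n=0}^\infty$ of vector subspaces of $\mathscr{U}$ is an $\mathbb{N}$-filtration of the Lie algebra $\mathscr{U}$.
   Context: The Lie bracket on $\mathscr{U}$ is $[f,g]=fg-gf$. The elements $x^ky^l$ ($k,l\in\mathbb{N}$, where $\mathbb{N}$ is the set of nonnegative integers) form an $\mathbb{F}$-basis of $\mathscr{U}$. For vector subspaces $\mathfrak{g}_1,\mathfrak{g}_2$ of a Lie algebra $\mathfrak{g}$ over $\mathbb{F}$, $[\mathfrak{g}_1,\mathfrak{g}_2]$ denotes the $\mathbb{F}$-linear span of all $[a,b]$ with $a\in\mathfrak{g}_1$, $b\in\mathfrak{g}_2$. A sequence $(\mathfrak{g}_n)_{n=0}^\infty$ of vector subspaces of $\mathfrak{g}$ is an $\mathbb{N}$-filtration of $\mathfrak{g}$ if for all $p,q\in\mathbb{N}$: $\mathfrak{g}_p\subseteq\mathfrak{g}_{p+1}$, $[\mathfrak{g}_p,\mathfrak{g}_q]\subseteq\mathfrak{g}_{p+q}$, and $\bigcup_{n=0}^\infty\mathfrak{g}_n=\mathfrak{g}$. *)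

theory Defs
  imports "HOL.Vector_Spaces" "HOL-Library.Poly_Mapping"
begin

locale lie_algebra = vector_space scale
  for scale :: "'f::field \<Rightarrow> 'g::ab_group_add \<Rightarrow> 'g" +
  fixes bracket :: "'g \<Rightarrow> 'g \<Rightarrow> 'g"
  assumes bracket_add_left: "bracket (a + b) c = bracket a c + bracket b c"
    and bracket_add_right: "bracket a (b + c) = bracket a b + bracket a c"
    and bracket_scale_left: "bracket (scale r a) b = scale r (bracket a b)"
    and bracket_scale_right: "bracket a (scale r b) = scale r (bracket a b)"
    and bracket_self: "bracket a a = 0"
    and jacobi: "bracket a (bracket b c) + bracket b (bracket c a) + bracket c (bracket a b) = 0"
begin

definition bracket_space :: "'g set \<Rightarrow> 'g set \<Rightarrow> 'g set"
  where "bracket_space A B = span {bracket a b | a b. a \<in> A \<and> b \<in> B}"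

end

locale nat_filtration = lie_algebra scale bracket
  for scale :: "'f::field \<Rightarrow> 'g::ab_group_add \<Rightarrow> 'g"
    and bracket :: "'g \<Rightarrow> 'g \<Rightarrow> 'g" +
  fixes G :: "nat \<Rightarrow> 'g set"
  assumes filtration_subspace: "subspace (G n)"
    and filtration_step: "G p \<subseteq> G (p + 1)"
    and filtration_bracket: "bracket_space (G p) (G q) \<subseteq> G (p + q)"
    and filtration_exhaustive: "(\<Union>n. G n) = UNIV"

datatype generator = Gen_x | Gen_y

text \<open>Words form the free monoid on the two generators. It is written additively, so that the
  convolution product of \<open>Poly_Mapping\<close> turns \<open>word \<Rightarrow>\<^sub>0 'f\<close> into the free
  algebra.\<close>

datatype word = Word (letters: "generator list")

instantiation word :: monoid_add
begin

definition zero_word :: word where "0 = Word []"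

definition plus_word :: "word \<Rightarrow> word \<Rightarrow> word"
  where "u + v = Word (letters u @ letters v)"

instance
  by standard (simp_all add: zero_word_def plus_word_def)

end

lemma word_add_eq_0_iff: "u + v = 0 \<longleftrightarrow> u = 0 \<and> v = (0 :: word)"
  by (cases u; cases v) (auto simp: zero_word_def plus_word_def)

type_synonym 'f free_alg = "word \<Rightarrow>\<^sub>0 'f"

definition free_gen :: "generator \<Rightarrow> 'f::field free_alg"
  where "free_gen g = Poly_Mapping.single (Word [g]) 1"

definition free_const :: "'f::field \<Rightarrow> 'f free_alg"
  where "free_const c = Poly_Mapping.single 0 c"

lemma free_const_0 [simp]: "free_const 0 = 0"
  and free_const_1 [simp]: "free_const 1 = 1"
  and free_const_add: "free_const (c + d) = free_const c + free_const d"
  and free_const_mult: "free_const (c * d) = free_const c * free_const d"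
  by (simp_all add: free_const_def single_add mult_single)

lemma free_const_central: "free_const c * p = p * free_const (c :: 'f::field)"
proof -
  have "Poly_Mapping.lookup (p * free_const c) k = Poly_Mapping.lookup p k * c" for k :: word
  proof -
    have "Poly_Mapping.lookup (p * free_const c) k
        = (\<Sum>l. Poly_Mapping.lookup p l * (\<Sum>q. (c when 0 = q) when k = l + q))"
      by (simp add: lookup_mult free_const_def lookup_single)
    also have "(\<lambda>l. \<Sum>q. (c when 0 = q) when k = l + q) = (\<lambda>l. c when k = l)"
    proof
      fix l :: word
      have "(\<lambda>q. (c when 0 = q) when k = l + q) = (\<lambda>q. (c when k = l) when q = 0)"
        by (auto simp: fun_eq_iff when_def)
      then show "(\<Sum>q. (c when 0 = q) when k = l + q) = (c when k = l)"
        by (simp only: Sum_any_when_equal)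
    qed
    also have "(\<Sum>l. Poly_Mapping.lookup p l * (c when k = l)) = Poly_Mapping.lookup p k * c"
      by (simp add: mult_when)
    finally show ?thesis .
  qed
  moreover have "Poly_Mapping.lookup (free_const c * p) k = c * Poly_Mapping.lookup p k" for k
    by (simp add: free_const_def mult_map_scale_conv_mult [symmetric] map.rep_eq when_def)
  ultimately show ?thesis
    by (intro poly_mapping_eqI) (simp add: mult.commute)
qed

lemma free_gen_empty_word: "Poly_Mapping.lookup (free_gen g) 0 = 0"
  by (simp add: free_gen_def lookup_single zero_word_def)

lemma lookup_mult_empty_word:
  fixes p q :: "'f::field free_alg"
  shows "Poly_Mapping.lookup (p * q) 0 = Poly_Mapping.lookup p 0 * Poly_Mapping.lookup q 0"
proof -
  have "(\<lambda>l. Poly_Mapping.lookup p l * (\<Sum>u. Poly_Mapping.lookup q u when 0 = l + u))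
      = (\<lambda>l. Poly_Mapping.lookup p 0 * Poly_Mapping.lookup q 0 when l = 0)"
  proof
    fix l :: word
    have "(\<lambda>u. Poly_Mapping.lookup q u when 0 = l + u)
        = (\<lambda>u. (Poly_Mapping.lookup q 0 when l = 0) when u = 0)"
      by (auto simp: fun_eq_iff when_def word_add_eq_0_iff dest: sym)
    then show "Poly_Mapping.lookup p l * (\<Sum>u. Poly_Mapping.lookup q u when 0 = l + u)
        = (Poly_Mapping.lookup p 0 * Poly_Mapping.lookup q 0 when l = 0)"
      by (simp only: Sum_any_when_equal) (simp add: when_def)
  qed
  then show ?thesis
    by (simp only: lookup_mult Sum_any_when_equal)
qed

definition two_sided_ideal :: "'r::ring_1 set \<Rightarrow> bool"
  where "two_sided_ideal I \<longleftrightarrow> 0 \<in> I \<and> (\<forall>a\<in>I. \<forall>b\<in>I. a + b \<in> I)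
    \<and> (\<forall>a\<in>I. \<forall>r. r * a \<in> I \<and> a * r \<in> I)"

text \<open>Since the scalars are central elements of the free algebra, two-sided ideals in the ring
  sense are the same as two-sided algebra ideals.\<close>

definition relation_ideal :: "'f::field free_alg set"
  where "relation_ideal = two_sided_ideal hull
    {free_gen Gen_x * free_gen Gen_y - free_gen Gen_y * free_gen Gen_x - free_gen Gen_x}"

lemma two_sided_ideal_relation_ideal: "two_sided_ideal relation_ideal"
  unfolding relation_ideal_def by (rule hull_in) (auto simp: two_sided_ideal_def)

lemma relation_ideal_0: "0 \<in> relation_ideal"
  and relation_ideal_add: "a \<in> relation_ideal \<Longrightarrow> b \<in> relation_ideal \<Longrightarrow> a + b \<in> relation_ideal"
  and relation_ideal_left: "a \<in> relation_ideal \<Longrightarrow> r * a \<in> relation_ideal"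
  and relation_ideal_right: "a \<in> relation_ideal \<Longrightarrow> a * r \<in> relation_ideal"
  using two_sided_ideal_relation_ideal unfolding two_sided_ideal_def by blast+

lemma relation_ideal_uminus: "a \<in> relation_ideal \<Longrightarrow> - a \<in> relation_ideal"
  using relation_ideal_left [of a "- 1"] by simp

lemma relation_ideal_diff:
  "a \<in> relation_ideal \<Longrightarrow> b \<in> relation_ideal \<Longrightarrow> a - b \<in> relation_ideal"
  using relation_ideal_add [of a "- b"] relation_ideal_uminus [of b] by simp

lemma one_notin_relation_ideal: "1 \<notin> (relation_ideal :: 'f::field free_alg set)"
proof -
  have "relation_ideal \<subseteq> {p :: 'f free_alg. Poly_Mapping.lookup p 0 = 0}"
    unfolding relation_ideal_def
  proof (rule hull_minimal)
    show "two_sided_ideal {p :: 'f free_alg. Poly_Mapping.lookup p 0 = 0}"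
      by (simp add: two_sided_ideal_def lookup_add lookup_mult_empty_word)
    show "{free_gen Gen_x * free_gen Gen_y - free_gen Gen_y * free_gen Gen_x - free_gen Gen_x}
        \<subseteq> {p :: 'f free_alg. Poly_Mapping.lookup p 0 = 0}"
      using free_gen_empty_word
      by (simp add: lookup_minus lookup_mult_empty_word)
  qed
  then show ?thesis
    by (auto simp: lookup_one)
qed

definition relation_cong :: "'f::field free_alg \<Rightarrow> 'f free_alg \<Rightarrow> bool"
  where "relation_cong p q \<longleftrightarrow> p - q \<in> relation_ideal"

lemma equivp_relation_cong: "equivp (relation_cong :: 'f::field free_alg \<Rightarrow> _)"
proof (rule equivpI)
  show "reflp (relation_cong :: 'f free_alg \<Rightarrow> _)"
    by (rule reflpI) (simp add: relation_cong_def relation_ideal_0)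
  show "symp (relation_cong :: 'f free_alg \<Rightarrow> _)"
  proof (rule sympI)
    fix p q :: "'f free_alg"
    assume "relation_cong p q"
    then show "relation_cong q p"
      using relation_ideal_uminus [of "p - q"] by (simp add: relation_cong_def)
  qed
  show "transp (relation_cong :: 'f free_alg \<Rightarrow> _)"
  proof (rule transpI)
    fix p q r :: "'f free_alg"
    assume "relation_cong p q" "relation_cong q r"
    then show "relation_cong p r"
      using relation_ideal_add [of "p - q" "q - r"] by (simp add: relation_cong_def)
  qed
qed

quotient_type (overloaded) 'f U = "'f::field free_alg" / relation_cong
  by (rule equivp_relation_cong)

instantiation U :: (field) ring_1
begin

lift_definition zero_U :: "'a U" is "0 :: 'a free_alg" .

lift_definition one_U :: "'a U" is "1 :: 'a free_alg" .

lift_definition plus_U :: "'a U \<Rightarrow> 'a U \<Rightarrow> 'a U"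
  is "(+) :: 'a free_alg \<Rightarrow> 'a free_alg \<Rightarrow> 'a free_alg"
proof -
  fix p p' q q' :: "'a free_alg"
  assume "relation_cong p p'" "relation_cong q q'"
  moreover have "p + q - (p' + q') = (p - p') + (q - q')"
    by simp
  ultimately show "relation_cong (p + q) (p' + q')"
    unfolding relation_cong_def by (metis relation_ideal_add)
qed

lift_definition uminus_U :: "'a U \<Rightarrow> 'a U" is "uminus :: 'a free_alg \<Rightarrow> 'a free_alg"
proof -
  fix p p' :: "'a free_alg"
  assume "relation_cong p p'"
  moreover have "- p - - p' = - (p - p')"
    by simp
  ultimately show "relation_cong (- p) (- p')"
    unfolding relation_cong_def by (metis relation_ideal_uminus)
qed

lift_definition minus_U :: "'a U \<Rightarrow> 'a U \<Rightarrow> 'a U"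
  is "(-) :: 'a free_alg \<Rightarrow> 'a free_alg \<Rightarrow> 'a free_alg"
proof -
  fix p p' q q' :: "'a free_alg"
  assume "relation_cong p p'" "relation_cong q q'"
  moreover have "p - q - (p' - q') = (p - p') - (q - q')"
    by simp
  ultimately show "relation_cong (p - q) (p' - q')"
    unfolding relation_cong_def by (metis relation_ideal_diff)
qed

lift_definition times_U :: "'a U \<Rightarrow> 'a U \<Rightarrow> 'a U"
  is "(*) :: 'a free_alg \<Rightarrow> 'a free_alg \<Rightarrow> 'a free_alg"
proof -
  fix p p' q q' :: "'a free_alg"
  assume "relation_cong p p'" "relation_cong q q'"
  moreover have "p * q - p' * q' = (p - p') * q + p' * (q - q')"
    by (simp add: algebra_simps)
  ultimately show "relation_cong (p * q) (p' * q')"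
    unfolding relation_cong_def
    by (simp add: relation_ideal_add relation_ideal_left relation_ideal_right)
qed

instance
proof
  fix a b c :: "'a U"
  show "a + b + c = a + (b + c)"
    by transfer (simp add: relation_cong_def relation_ideal_0 algebra_simps)
  show "a + b = b + a"
    by transfer (simp add: relation_cong_def relation_ideal_0 algebra_simps)
  show "0 + a = a"
    by transfer (simp add: relation_cong_def relation_ideal_0 algebra_simps)
  show "- a + a = 0"
    by transfer (simp add: relation_cong_def relation_ideal_0 algebra_simps)
  show "a - b = a + - b"
    by transfer (simp add: relation_cong_def relation_ideal_0 algebra_simps)
  show "a * b * c = a * (b * c)"
    by transfer (simp add: relation_cong_def relation_ideal_0 algebra_simps)
  show "1 * a = a"
    by transfer (simp add: relation_cong_def relation_ideal_0 algebra_simps)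
  show "a * 1 = a"
    by transfer (simp add: relation_cong_def relation_ideal_0 algebra_simps)
  show "(a + b) * c = a * c + b * c"
    by transfer (simp add: relation_cong_def relation_ideal_0 algebra_simps)
  show "a * (b + c) = a * b + a * c"
    by transfer (simp add: relation_cong_def relation_ideal_0 algebra_simps)
  show "(0 :: 'a U) \<noteq> 1"
  proof transfer
    show "\<not> relation_cong (0 :: 'a free_alg) 1"
      using one_notin_relation_ideal relation_ideal_uminus [of "- 1 :: 'a free_alg"]
      by (auto simp: relation_cong_def)
  qed
qed

end

lift_definition U_x :: "'f::field U" is "free_gen Gen_x" .

lift_definition U_y :: "'f::field U" is "free_gen Gen_y" .

lift_definition U_const :: "'f::field \<Rightarrow> 'f U" is free_const .

definition U_scale :: "'f::field \<Rightarrow> 'f U \<Rightarrow> 'f U"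
  where "U_scale c u = U_const c * u"

lemma U_relation: "U_x * U_y - U_y * U_x = (U_x :: 'f::field U)"
  by transfer (auto simp: relation_cong_def relation_ideal_def intro: hull_inc)

lemma U_const_central: "U_const c * u = u * U_const c"
  by transfer (simp add: relation_cong_def free_const_central relation_ideal_0)

lemma U_scale_mult_left: "U_scale c u * v = U_scale c (u * v)"
  and U_scale_mult_right: "u * U_scale c v = U_scale c (u * v)"
  unfolding U_scale_def by (metis U_const_central mult.assoc)+

global_interpretation U: vector_space "U_scale :: 'f::field \<Rightarrow> 'f U \<Rightarrow> 'f U"
proof
  fix c d :: 'f and u v :: "'f U"
  show "U_scale c (u + v) = U_scale c u + U_scale c v"
    by (simp add: U_scale_def distrib_left)
  show "U_scale (c + d) u = U_scale c u + U_scale d u"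
    unfolding U_scale_def
    by transfer (simp add: relation_cong_def free_const_add distrib_right relation_ideal_0)
  show "U_scale c (U_scale d u) = U_scale (c * d) u"
    unfolding U_scale_def
    by transfer (simp add: relation_cong_def free_const_mult mult.assoc relation_ideal_0)
  show "U_scale 1 u = u"
    unfolding U_scale_def by transfer (simp add: relation_cong_def relation_ideal_0)
qed

definition U_bracket :: "'f::field U \<Rightarrow> 'f U \<Rightarrow> 'f U"
  where "U_bracket f g = f * g - g * f"

definition y_degree_filtration :: "nat \<Rightarrow> 'f::field U set"
  where "y_degree_filtration n = U.span {U_x ^ k * U_y ^ l | k l. l \<le> n}"

end

theory Submission
  imports Defs
begin

text \<open>The relation reads \<open>y x = x y - x\<close>, so moving \<open>y\<close> past \<open>x\<^sup>k\<close> gives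
  \<open>y x\<^sup>k y\<^sup>l = x\<^sup>k y\<^sup>l\<^sup>+\<^sup>1 - k x\<^sup>k y\<^sup>l\<close>. Hence left multiplication by
  \<open>x\<close> preserves each \<open>\<F>\<^sub>n\<close> and left multiplication by \<open>y\<close> raises \<open>n\<close> by one. It follows
  that \<open>\<F>\<^sub>p \<F>\<^sub>q \<subseteq> \<F>\<^sub>p\<^sub>+\<^sub>q\<close>, which is stronger than the bracket condition, and that every word in
  \<open>x\<close> and \<open>y\<close> lies in some \<open>\<F>\<^sub>n\<close>.\<close>

lemma lie_algebra_U: "lie_algebra (U_scale :: 'f::field \<Rightarrow> 'f U \<Rightarrow> 'f U) U_bracket"
proof (rule lie_algebra.intro [OF U.vector_space_axioms], unfold_locales)
  fix a b c :: "'f U" and r :: 'f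
  show "U_bracket (a + b) c = U_bracket a c + U_bracket b c"
    and "U_bracket a (b + c) = U_bracket a b + U_bracket a c"
    and "U_bracket a a = 0"
    and "U_bracket a (U_bracket b c) + U_bracket b (U_bracket c a) + U_bracket c (U_bracket a b) = 0"
    by (simp_all add: U_bracket_def algebra_simps)
  show "U_bracket (U_scale r a) b = U_scale r (U_bracket a b)"
    and "U_bracket a (U_scale r b) = U_scale r (U_bracket a b)"
    by (simp_all add: U_bracket_def U_scale_mult_left U_scale_mult_right U.scale_right_diff_distrib)
qed

text \<open>Induction on \<open>k\<close>: by the relation, each factor \<open>x\<close> that
  \<open>y\<close> passes leaves behind one copy of \<open>- x^k\<close>.\<close>

lemma U_y_mult_power_U_x:
  "U_y * U_x ^ k = U_x ^ k * U_y - of_nat k * (U_x ^ k :: 'f::field U)"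
proof (induction k)
  case 0
  then show ?case by simp
next
  case (Suc k)
  have yx: "U_y * U_x = U_x * U_y - (U_x :: 'f U)"
    using U_relation [where 'f = 'f] by (simp add: algebra_simps)
  have "U_y * U_x ^ Suc k = U_x * (U_y * U_x ^ k) - (U_x :: 'f U) * U_x ^ k"
    by (simp add: yx left_diff_distrib flip: mult.assoc)
  also have "\<dots> = U_x ^ Suc k * U_y - of_nat (Suc k) * U_x ^ Suc k"
    \<comment> \<open>The coefficient from the induction hypothesis stands to the right of the new
      \<open>x\<close> and has to be moved in front of it.\<close>
    using mult_of_nat_commute [of k "U_x :: 'f U"]
    by (simp add: Suc.IH algebra_simps) (simp flip: mult.assoc)
  finally show ?case .
qed

text \<open>The preimage of a subspace under a linear map is a subspace. This reduces each closure
  property of the filtration to a check on monomials.\<close>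

lemma (in vector_space) span_linear_image_subset:
  assumes "Vector_Spaces.linear scale scale f"
    and "\<And>s. s \<in> S \<Longrightarrow> f s \<in> T" "subspace T" "v \<in> span S"
  shows "f v \<in> T"
proof -
  interpret f: Vector_Spaces.linear scale scale f
    by (fact assms)
  have "span S \<subseteq> f -` T"
    using assms(2) by (intro span_minimal f.subspace_vimage assms(3)) auto
  then show ?thesis
    using assms(4) by blast
qed

lemma linear_U_mult_left: "Vector_Spaces.linear U_scale U_scale (\<lambda>v. u * v)"
  and linear_U_mult_right: "Vector_Spaces.linear U_scale U_scale (\<lambda>u. u * v)"
  for u v :: "'f::field U"
  by unfold_locales (simp_all add: algebra_simps U_scale_mult_left U_scale_mult_right)

lemma subspace_y_degree_filtration: "U.subspace (y_degree_filtration n)"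
  by (simp add: y_degree_filtration_def)

lemma y_degree_filtration_monomial: "l \<le> n \<Longrightarrow> U_x ^ k * U_y ^ l \<in> y_degree_filtration n"
  unfolding y_degree_filtration_def by (rule U.span_base) blast

lemma y_degree_filtration_mono: "m \<le> n \<Longrightarrow> y_degree_filtration m \<subseteq> y_degree_filtration n"
  unfolding y_degree_filtration_def by (rule U.span_mono) (auto intro: order_trans)

text \<open>The coefficient in the commutation formula is an element of \<open>U\<close>, not a
  scalar, so closure comes from repeated addition.\<close>

lemma y_degree_filtration_of_nat_mult:
  "v \<in> y_degree_filtration n \<Longrightarrow> of_nat k * v \<in> y_degree_filtration n"
  by (induction k)
    (auto simp: distrib_right intro: U.subspace_add U.subspace_0 subspace_y_degree_filtration)

lemma U_x_mult_y_degree_filtration: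
  assumes "v \<in> y_degree_filtration n"
  shows "U_x * v \<in> y_degree_filtration n"
proof (rule U.span_linear_image_subset [OF linear_U_mult_left _ subspace_y_degree_filtration])
  show "v \<in> U.span {U_x ^ k * U_y ^ l | k l. l \<le> n}"
    using assms by (simp add: y_degree_filtration_def)
next
  fix s :: "'a U"
  assume "s \<in> {U_x ^ k * U_y ^ l | k l. l \<le> n}"
  then obtain k l where "U_x * s = U_x ^ Suc k * U_y ^ l" "l \<le> n"
    by (auto simp: mult.assoc)
  then show "U_x * s \<in> y_degree_filtration n"
    by (metis y_degree_filtration_monomial)
qed

lemma U_y_mult_y_degree_filtration:
  assumes "v \<in> y_degree_filtration n"
  shows "U_y * v \<in> y_degree_filtration (Suc n)"
proof (rule U.span_linear_image_subset [OF linear_U_mult_left _ subspace_y_degree_filtration])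
  show "v \<in> U.span {U_x ^ k * U_y ^ l | k l. l \<le> n}"
    using assms by (simp add: y_degree_filtration_def)
next
  fix s :: "'a U"
  assume "s \<in> {U_x ^ k * U_y ^ l | k l. l \<le> n}"
  then obtain k l where s: "s = U_x ^ k * U_y ^ l" and l: "l \<le> n"
    by blast
  have "U_y * s = U_x ^ k * U_y ^ Suc l - of_nat k * (U_x ^ k * U_y ^ l)"
    unfolding s by (simp add: U_y_mult_power_U_x left_diff_distrib mult.assoc flip: mult.assoc [of U_y])
  moreover have "U_x ^ k * U_y ^ Suc l \<in> y_degree_filtration (Suc n)"
    using l by (intro y_degree_filtration_monomial) simp
  moreover have "of_nat k * (U_x ^ k * U_y ^ l) \<in> y_degree_filtration (Suc n)"
    using l by (intro y_degree_filtration_of_nat_mult y_degree_filtration_monomial) simp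
  ultimately show "U_y * s \<in> y_degree_filtration (Suc n)"
    by (metis U.subspace_diff subspace_y_degree_filtration)
qed

text \<open>Linearity in \<open>u\<close> reduces to \<open>u = x^k y^l\<close> with
  \<open>v\<close> left arbitrary; then \<open>l\<close> multiplications by \<open>y\<close>
  followed by \<open>k\<close> by \<open>x\<close> raise the index by \<open>l\<close> only.\<close>

lemma y_degree_filtration_mult:
  assumes "u \<in> y_degree_filtration p" "v \<in> y_degree_filtration q"
  shows "u * v \<in> y_degree_filtration (p + q)"
proof (rule U.span_linear_image_subset [OF linear_U_mult_right _ subspace_y_degree_filtration])
  show "u \<in> U.span {U_x ^ k * U_y ^ l | k l. l \<le> p}"
    using assms by (simp add: y_degree_filtration_def)
next
  fix s :: "'a U"
  assume "s \<in> {U_x ^ k * U_y ^ l | k l. l \<le> p}"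
  then obtain k l where s: "s = U_x ^ k * U_y ^ l" and l: "l \<le> p"
    by blast
  have "U_y ^ l * v \<in> y_degree_filtration (l + q)"
    by (induction l) (auto simp: mult.assoc assms(2) intro: U_y_mult_y_degree_filtration)
  then have "U_x ^ k * (U_y ^ l * v) \<in> y_degree_filtration (l + q)"
    by (induction k) (auto simp: mult.assoc intro: U_x_mult_y_degree_filtration)
  then show "s * v \<in> y_degree_filtration (p + q)"
    using l y_degree_filtration_mono [of "l + q" "p + q"] by (auto simp: s mult.assoc)
qed

text \<open>Letters are peeled off from the left, each acting by left multiplication; the
  coefficient \<open>c\<close> stays with the remaining word down to the empty one.\<close>

lemma U_word_in_y_degree_filtration:
  "\<exists>n. abs_U (Poly_Mapping.single (Word gs) c) \<in> y_degree_filtration n"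
proof (induction gs)
  case Nil
  have "abs_U (Poly_Mapping.single (Word []) c) = U_scale c (U_x ^ 0 * U_y ^ 0)"
    by (simp add: U_scale_def U_const.abs_eq free_const_def zero_word_def)
  then have "abs_U (Poly_Mapping.single (Word []) c) \<in> y_degree_filtration 0"
    by (metis U.subspace_scale subspace_y_degree_filtration y_degree_filtration_monomial order_refl)
  then show ?case ..
next
  case (Cons g gs)
  have "abs_U (Poly_Mapping.single (Word (g # gs)) c)
      = abs_U (free_gen g) * abs_U (Poly_Mapping.single (Word gs) c)"
    by (simp add: times_U.abs_eq free_gen_def mult_single plus_word_def)
  then show ?case
    using Cons.IH
    by (cases g)
      (auto simp flip: U_x.abs_eq U_y.abs_eq
        intro: U_x_mult_y_degree_filtration U_y_mult_y_degree_filtration)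
qed

lemma poly_mapping_single_add_induct [case_names single add]:
  assumes "\<And>k v. P (Poly_Mapping.single k v)"
    and "\<And>p q. P p \<Longrightarrow> P q \<Longrightarrow> P (p + q)"
  shows "P (p :: 'k \<Rightarrow>\<^sub>0 'v::monoid_add)"
proof (induction p rule: update_induct)
  case const
  then show ?case
    \<comment> \<open>The zero mapping is \<open>single\<close> with value 0 at any key.\<close>
    using assms(1) [of undefined 0] by simp
next
  case (update p k v)
  \<comment> \<open>Here \<open>k\<close> lies outside the support of \<open>p\<close>, so
    overwriting the value at \<open>k\<close> is the same as adding to it.\<close>
  then have "Poly_Mapping.update k v p = p + Poly_Mapping.single k v"
    by (intro poly_mapping_eqI)
      (auto simp: lookup_update lookup_add lookup_single in_keys_iff when_def)
  then show ?case
    using update.IH assms by metis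
qed

text \<open>Every element is the class of a finite sum of scaled words; since the filtration
  increases, the maximum of two indices serves for a sum.\<close>

lemma y_degree_filtration_exhaustive: "\<exists>n. (u :: 'f::field U) \<in> y_degree_filtration n"
proof -
  have "\<exists>n. abs_U p \<in> y_degree_filtration n" for p :: "'f free_alg"
  proof (induction p rule: poly_mapping_single_add_induct)
    case (single w c)
    then show ?case
      by (cases w) (simp add: U_word_in_y_degree_filtration)
  next
    case (add p q)
    then obtain m n where "abs_U p \<in> y_degree_filtration m" "abs_U q \<in> y_degree_filtration n"
      by blast
    then have "abs_U p \<in> y_degree_filtration (max m n)" "abs_U q \<in> y_degree_filtration (max m n)"
      using y_degree_filtration_mono by (meson max.cobounded1 max.cobounded2 subsetD)+
    then have "abs_U (p + q) \<in> y_degree_filtration (max m n)"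
      by (simp add: U.subspace_add subspace_y_degree_filtration flip: plus_U.abs_eq)
    then show ?case ..
  qed
  then show ?thesis
    by (induction u rule: U.abs_induct)
qed

theorem proposition3p3:
  shows "nat_filtration (U_scale :: 'f::field_char_0 \<Rightarrow> 'f U \<Rightarrow> 'f U) U_bracket y_degree_filtration"
proof -
  interpret lie_algebra "U_scale :: 'f \<Rightarrow> 'f U \<Rightarrow> 'f U" U_bracket
    by (rule lie_algebra_U)
  show ?thesis
  proof
    fix n p q
    show "U.subspace (y_degree_filtration n :: 'f U set)"
      by (rule subspace_y_degree_filtration)
    show "y_degree_filtration p \<subseteq> (y_degree_filtration (p + 1) :: 'f U set)"
      by (rule y_degree_filtration_mono) simp
    show "bracket_space (y_degree_filtration p) (y_degree_filtration q)
        \<subseteq> (y_degree_filtration (p + q) :: 'f U set)"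
      unfolding bracket_space_def
    proof (rule U.span_minimal [OF _ subspace_y_degree_filtration], safe)
      fix a b :: "'f U"
      assume ab: "a \<in> y_degree_filtration p" "b \<in> y_degree_filtration q"
      \<comment> \<open>Both terms of the commutator lie in the subspace separately.\<close>
      then have "a * b \<in> y_degree_filtration (p + q)" "b * a \<in> y_degree_filtration (p + q)"
        using y_degree_filtration_mult [of a p b q] y_degree_filtration_mult [of b q a p]
        by (simp_all add: add.commute)
      then show "U_bracket a b \<in> y_degree_filtration (p + q)"
        unfolding U_bracket_def by (rule U.subspace_diff [OF subspace_y_degree_filtration])
    qed
    show "(\<Union>n. y_degree_filtration n) = (UNIV :: 'f U set)"
      using y_degree_filtration_exhaustive by blast
  qed
qed

end
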